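(* Let $1\le i\le k<n$ and let $\alpha_{i,n}$ be an arbitrary positive real number. The cdf $H$ of $\sigma^{-1}\alpha_{i,n}(\tilde\theta_{H,i}-\theta_i)$ under $P_{n,\theta,\sigma}$ is given by $$H(x)=\Phi\left(n^{1/2}x/(\alpha_{i,n}\xi_{i,n})\right)\int_0^\infty\mathbf{1}\left(|\alpha_{i,n}^{-1}x+\theta_i/\sigma|>\xi_{i,n}s\eta_{i,n}\right)\rho_{n-k}(s)\,ds$$ $$+\int_0^\infty\Phi\left(n^{1/2}(-\theta_i/(\sigma\xi_{i,n})+s\eta_{i,n})\right)\mathbf{1}\left(0\le\alpha_{i,n}^{-1}x+\theta_i/\sigma\le\xi_{i,n}s\eta_{i,n}\right)\rho_{n-k}(s)\,ds$$ $$+\int_0^\infty\Phi\left(n^{1/2}(-\theta_i/(\sigma\xi_{i,n})-s\eta_{i,n})\right)\mathbf{1}\left(-\xi_{i,n}s\eta_{i,n}\le\alpha_{i,n}^{-1}x+\theta_i/\sigma<0\right)\rho_{n-k}(s)\,ds.$$ Or, equivalently, the corresponding measure is $$dH(x)=\int_0^\infty\left\{\Phi\left(n^{1/2}(-\theta_i/(\sigma\xi_{i,n})+s\eta_{i,n})\right)-\Phi\left(n^{1/2}(-\theta_i/(\sigma\xi_{i,n})-s\eta_{i,n})\right)\right\}\rho_{n-k}(s)\,ds\;d\delta_{-\alpha_{i,n}\theta_i/\sigma}(x)$$ $$+\,n^{1/2}\alpha_{i,n}^{-1}\xi_{i,n}^{-1}\phi\left(n^{1/2}x/(\alpha_{i,n}\xi_{i,n})\right)\int_0^\infty\mathbf{1}\left(|\alpha_{i,n}^{-1}x+\theta_i/\sigma|>\xi_{i,n}s\eta_{i,n}\right)\rho_{n-k}(s)\,ds\,dx,$$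 where $\delta_z$ denotes pointmass at $z$.
   Context: Consider the linear regression model $Y=X\theta+u$, where $X$ is a nonstochastic $n\times k$ matrix of rank $k\ge1$ with $n>k$, $\theta\in\mathbb{R}^k$, $u\sim N(0,\sigma^2I_n)$, $0<\sigma<\infty$; $P_{n,\theta,\sigma}$ denotes probability under parameters $\theta,\sigma$. $X'$ is the transpose of $X$. $\xi_{i,n}$ is the nonnegative square root of the $i$-th diagonal element of $(X'X/n)^{-1}$. $\hat\theta_{LS}=(X'X)^{-1}X'Y$ with $i$-th component $\hat\theta_{LS,i}$, and $\hat\sigma^2=(n-k)^{-1}(Y-X\hat\theta_{LS})'(Y-X\hat\theta_{LS})$, $\hat\sigma\ge0$. The tuning parameter $\eta_{i,n}$ is a positive real number. The hard-thresholding estimator is $\tilde\theta_{H,i}=\hat\theta_{LS,i}\mathbf{1}(|\hat\theta_{LS,i}|>\hat\sigma\xi_{i,n}\eta_{i,n})$. $\Phi,\phi$ are the standard normal cdf and pdf. $\rho_m$ is the density of $m^{-1/2}$ times the square root of a chi-square random variable with $m$ degrees of freedom. *)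

theory Defs
  imports "HOL-Probability.Probability"
begin

definition multivariate_normal_density :: "real^'n \<Rightarrow> real^'n^'n \<Rightarrow> real^'n \<Rightarrow> real" where
  "multivariate_normal_density \<mu> S v =
     exp (- ((v - \<mu>) \<bullet> (matrix_inv S *v (v - \<mu>))) / 2) / sqrt ((2 * pi) ^ CARD('n) * det S)"

definition std_normal_cdf :: "real \<Rightarrow> real" where
  "std_normal_cdf = cdf std_normal_distribution"

definition chi_square :: "nat \<Rightarrow> real measure" where
  "chi_square m = distr (Pi\<^sub>M {..<m} (\<lambda>_. std_normal_distribution)) borel (\<lambda>z. \<Sum>j<m. (z j)\<^sup>2)"

(* The Radon-Nikodym derivative picks one version of the density with respect to Lebesgue
   measure; it exists for m > 0, where the law is absolutely continuous. *)
definition rho :: "nat \<Rightarrow> real \<Rightarrow> real" where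
  "rho m s = enn2real (RN_deriv lborel (distr (chi_square m) borel (\<lambda>q. sqrt q / sqrt (real m))) s)"

definition theta_LS :: "real^'k^'n \<Rightarrow> real^'n \<Rightarrow> real^'k" where
  "theta_LS X y = matrix_inv (transpose X ** X) *v (transpose X *v y)"

definition sigma_hat :: "real^'k^'n \<Rightarrow> real^'n \<Rightarrow> real" where
  "sigma_hat X y =
     sqrt (((y - X *v theta_LS X y) \<bullet> (y - X *v theta_LS X y)) / real (CARD('n) - CARD('k)))"

definition xi :: "real^'k^'n \<Rightarrow> 'k \<Rightarrow> real" where
  "xi X i = sqrt (matrix_inv ((1 / real CARD('n)) *\<^sub>R (transpose X ** X)) $ i $ i)"

definition theta_H :: "real^'k^'n \<Rightarrow> real \<Rightarrow> 'k \<Rightarrow> real^'n \<Rightarrow> real" where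
  "theta_H X \<eta> i y =
     theta_LS X y $ i * of_bool (\<bar>theta_LS X y $ i\<bar> > sigma_hat X y * xi X i * \<eta>)"

end

theory Submission
  imports Defs
begin

text \<open>
The proof conditions on the estimated standard deviation. Divide everything by \<open>\<sigma>\<close>. The
least-squares coefficient becomes \<open>\<theta>\<^sub>i / \<sigma> + \<kappa> * w\<close> with \<open>w\<close> standard normal and
\<open>\<kappa> = \<xi>\<^sub>i / sqrt n\<close>, and the estimated standard deviation becomes a variable \<open>s\<close>. Given \<open>s\<close>, the
estimator is a normal variable hard-thresholded at the known level \<open>\<xi>\<^sub>i * s * \<eta>\<close>. Its law has
an atom at the image of \<open>0\<close>, carrying the normal probability of the threshold interval, and
outside that interval it is the original normal law (\<open>measure_hard_threshold_le\<close>,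
\<open>emeasure_hard_threshold\<close>). Integrating over the law of \<open>s\<close>, with Tonelli's theorem for the
density part, gives both formulas (\<open>cdf_law\<close>, \<open>emeasure_law\<close>).

This rests on two classical facts. First, \<open>w\<close> and \<open>s\<close> are independent, and \<open>(n - k) * s\<^sup>2\<close> has
a chi-square law with \<open>n - k\<close> degrees of freedom. Indeed, in a suitable orthonormal basis \<open>w\<close> is one
coordinate of \<open>u / \<sigma>\<close>, and \<open>(n - k) * s\<^sup>2\<close> is the sum of the squares of \<open>n - k\<close> other coordinates
(\<open>adapted_orthonormal_basis\<close>), while the coordinates of a spherical normal vector in any
orthonormal basis are independent standard normal (\<open>normal_vector_orthonormal_coordinates\<close>). The
latter is rotation invariance, which comes down to rotation invariance of Lebesgue measure
(\<open>lborel_orthogonal_transformation\<close>).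

Second, the law of \<open>s\<close> has a density, so that the Radon-Nikodym derivative \<open>rho\<close> really
represents it (\<open>scaled_chi_absolutely_continuous\<close>, \<open>scaled_chi_eq_density\<close>).
\<close>

section \<open>Rotation invariance of Lebesgue measure\<close>

text \<open>The argument is the one for uniqueness of Haar measure. Both \<open>lborel\<close> and its image under
\<open>f\<close> are translation invariant, so in
\<open>\<integral>\<integral> g (f x) * h y\<close> one may first shift \<open>y\<close> by \<open>f x\<close>, then shift \<open>x\<close> so that \<open>f x\<close> becomes
\<open>f x + y\<close>, and the double integral turns into \<open>\<integral> g * \<integral> h (- f x)\<close>. With the
indicator of the unit ball for \<open>h\<close>, which is unaffected by \<open>x \<mapsto> - f x\<close>, its positive and
finite volume cancels.\<close>

lemma lborel_orthogonal_transformation: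
  fixes f :: "'a::euclidean_space \<Rightarrow> 'a"
  assumes f: "orthogonal_transformation f"
  shows "distr lborel borel f = lborel"
proof (rule measure_eqI)
  have lin: "linear f" and nf: "\<And>x. norm (f x) = norm x"
    using f orthogonal_transformation by auto
  have [measurable]: "f \<in> borel_measurable borel"
    using lin by (intro borel_measurable_continuous_onI linear_continuous_on) (simp add: linear_conv_bounded_linear)
  have surj: "surj f" using f by (rule orthogonal_transformation_surj)
  fix A assume "A \<in> sets (distr lborel borel f)"
  then have A[measurable]: "A \<in> sets borel" by simp
  define g :: "'a \<Rightarrow> ennreal" where "g = indicator A"
  define h :: "'a \<Rightarrow> ennreal" where "h = indicator (ball 0 1)"
  have [measurable]: "g \<in> borel_measurable borel" "h \<in> borel_measurable borel"
    unfolding g_def h_def by (simp_all add: borel_measurable_indicator)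
  have shift: "(\<integral>\<^sup>+x. k (x + c) \<partial>lborel) = (\<integral>\<^sup>+x. k x \<partial>lborel)"
    if [measurable]: "k \<in> borel_measurable borel" for k :: "'a \<Rightarrow> ennreal" and c
  proof -
    have "(\<integral>\<^sup>+x. k x \<partial>lborel) = (\<integral>\<^sup>+x. k x \<partial>distr lborel borel ((+) c))"
      by (simp add: lborel_distr_plus)
    then show ?thesis by (simp add: nn_integral_distr add.commute)
  qed
  have "(\<integral>\<^sup>+x. g (f x) \<partial>lborel) * (\<integral>\<^sup>+y. h y \<partial>lborel)
      = (\<integral>\<^sup>+x. (\<integral>\<^sup>+y. g (f x) * h y \<partial>lborel) \<partial>lborel)"
    by (simp add: nn_integral_cmult nn_integral_multc)
  also have "\<dots> = (\<integral>\<^sup>+x. (\<integral>\<^sup>+y. g (f x) * h (y - f x) \<partial>lborel) \<partial>lborel)"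
  proof (rule nn_integral_cong)
    fix x show "(\<integral>\<^sup>+y. g (f x) * h y \<partial>lborel) = (\<integral>\<^sup>+y. g (f x) * h (y - f x) \<partial>lborel)"
      using shift[of "\<lambda>y. g (f x) * h y" "- f x"] by simp
  qed
  also have "\<dots> = (\<integral>\<^sup>+y. (\<integral>\<^sup>+x. g (f x) * h (y - f x) \<partial>lborel) \<partial>lborel)"
    by (rule lborel_pair.Fubini') measurable
  also have "\<dots> = (\<integral>\<^sup>+y. (\<integral>\<^sup>+x. g (f x + y) * h (- f x) \<partial>lborel) \<partial>lborel)"
  proof (rule nn_integral_cong)
    fix y
    obtain z where z: "f z = y" using surj by (metis surjD)
    show "(\<integral>\<^sup>+x. g (f x) * h (y - f x) \<partial>lborel) = (\<integral>\<^sup>+x. g (f x + y) * h (- f x) \<partial>lborel)"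
      using shift[of "\<lambda>x. g (f x) * h (y - f x)" z] by (simp add: linear_add[OF lin] z)
  qed
  also have "\<dots> = (\<integral>\<^sup>+x. (\<integral>\<^sup>+y. g (f x + y) * h (- f x) \<partial>lborel) \<partial>lborel)"
    by (rule lborel_pair.Fubini') measurable
  also have "\<dots> = (\<integral>\<^sup>+x. (\<integral>\<^sup>+y. g y \<partial>lborel) * h (- f x) \<partial>lborel)"
  proof (rule nn_integral_cong)
    fix x show "(\<integral>\<^sup>+y. g (f x + y) * h (- f x) \<partial>lborel) = (\<integral>\<^sup>+y. g y \<partial>lborel) * h (- f x)"
      using shift[of g "f x"] by (simp add: nn_integral_multc add.commute)
  qed
  also have "\<dots> = (\<integral>\<^sup>+y. g y \<partial>lborel) * (\<integral>\<^sup>+x. h x \<partial>lborel)"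
  proof -
    have "h (- f x) = h x" for x by (simp add: h_def indicator_def nf)
    then show ?thesis by (simp add: nn_integral_cmult)
  qed
  finally have eq: "(\<integral>\<^sup>+x. g (f x) \<partial>lborel) * emeasure lborel (ball (0::'a) 1)
      = (\<integral>\<^sup>+y. g y \<partial>lborel) * emeasure lborel (ball (0::'a) 1)"
    by (simp add: h_def)
  have "emeasure lborel (ball (0::'a) 1) \<noteq> 0"
    using unit_ball_vol_pos[of "real DIM('a)"] by (simp add: emeasure_ball del: unit_ball_vol_pos)
  moreover have "emeasure lborel (ball (0::'a) 1) < top"
    by (simp add: emeasure_ball)
  ultimately have "(\<integral>\<^sup>+x. g (f x) \<partial>lborel) = (\<integral>\<^sup>+y. g y \<partial>lborel)"
    using eq by (metis ennreal_mult_divide_eq less_top)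
  moreover have "g (f x) = indicator (f -` A) x" for x
    by (simp add: g_def indicator_def)
  ultimately have "(\<integral>\<^sup>+x. indicator (f -` A) x \<partial>lborel) = emeasure lborel A"
    by (simp add: g_def)
  moreover have "f -` A \<in> sets borel" using measurable_sets[of f borel borel A] by simp
  ultimately show "emeasure (distr lborel borel f) A = emeasure lborel A"
    by (simp add: emeasure_distr)
qed simp

lemma orthonormal_basis_map:
  fixes B :: "'a::euclidean_space set"
  assumes orth: "pairwise orthogonal B" and unit: "\<And>b. b \<in> B \<Longrightarrow> norm b = 1"
    and card: "card B = DIM('a)"
  obtains Q :: "'a \<Rightarrow> 'a" where "orthogonal_transformation Q" "bij_betw Q Basis B"
proof -
  have fin: "finite B" using card by (metis DIM_positive card.infinite less_numeral_extra(3))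
  then obtain p :: "'a \<Rightarrow> 'a" where p: "bij_betw p Basis B"
    using card finite_same_card_bij[OF finite_Basis[where 'a='a] fin] by auto
  define Q where "Q x = (\<Sum>e\<in>Basis. (x \<bullet> e) *\<^sub>R p e)" for x :: 'a
  have lin: "linear Q"
    unfolding Q_def by (intro linear_compose_sum ballI linearI) (auto simp: algebra_simps inner_add_left)
  have pp: "p e \<bullet> p e' = (if e = e' then 1 else 0)" if "e \<in> Basis" "e' \<in> Basis" for e e'
  proof (cases "e = e'")
    case True
    then show ?thesis using unit[of "p e"] p that by (auto simp: bij_betw_def norm_eq_1)
  next
    case False
    then have "p e \<noteq> p e'" using p that by (auto simp: bij_betw_def inj_on_def)
    then show ?thesis using False orth p that by (auto simp: bij_betw_def pairwise_def orthogonal_def)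
  qed
  have "Q x \<bullet> Q y = x \<bullet> y" for x y
    by (simp add: Q_def inner_sum_left inner_sum_right pp if_distrib sum.If_cases euclidean_inner[of x y]
        mult.commute cong: sum.cong if_cong)
  then have ot: "orthogonal_transformation Q" using lin by (simp add: orthogonal_transformation_def)
  have "Q e = p e" if "e \<in> Basis" for e
  proof -
    have "Q e = (\<Sum>e'\<in>Basis. if e' = e then p e else 0)"
      unfolding Q_def using that by (intro sum.cong refl) (auto simp: inner_Basis)
    then show ?thesis using that by simp
  qed
  then have "bij_betw Q Basis B" using p bij_betw_cong by metis
  then show thesis using ot that by blast
qed

section \<open>Spherical normal vectors\<close>

text \<open>The law \<open>N(0, \<sigma>\<^sup>2 I)\<close>, on an arbitrary Euclidean space.\<close>

abbreviation normal_vector :: "real \<Rightarrow> 'a::euclidean_space measure" where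
  "normal_vector \<sigma> \<equiv> density lborel (\<lambda>v. ennreal (\<Prod>b\<in>Basis. normal_density 0 \<sigma> (v \<bullet> b)))"

text \<open>The product of the marginal densities depends on \<open>v\<close> only through its length, which is where
rotation invariance comes from.\<close>

lemma prod_normal_density_eq:
  fixes v :: "'a::euclidean_space"
  shows "(\<Prod>b\<in>Basis. normal_density 0 \<sigma> (v \<bullet> b))
    = exp (- (v \<bullet> v) / (2 * \<sigma>\<^sup>2)) / sqrt (2 * pi * \<sigma>\<^sup>2) ^ DIM('a)"
proof -
  have "(\<Prod>b\<in>Basis. normal_density 0 \<sigma> (v \<bullet> b))
      = exp (\<Sum>b\<in>Basis. - (v \<bullet> b)\<^sup>2 / (2 * \<sigma>\<^sup>2)) / sqrt (2 * pi * \<sigma>\<^sup>2) ^ DIM('a)"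
    by (simp add: normal_density_def exp_sum prod_dividef prod.distrib power_divide)
  also have "(\<Sum>b\<in>Basis. - (v \<bullet> b)\<^sup>2 / (2 * \<sigma>\<^sup>2)) = - (v \<bullet> v) / (2 * \<sigma>\<^sup>2)"
    by (simp add: euclidean_inner[of v v] power2_eq_square sum_negf flip: sum_divide_distrib)
  finally show ?thesis .
qed

lemma prob_space_std_normal: "prob_space std_normal_distribution"
  by (rule prob_space_normal_density) simp

text \<open>Standardisation in one dimension, in the form in which the factors of a product integral
over the coordinates present it.\<close>

lemma emeasure_normal_scaled:
  assumes "0 < \<sigma>" and [measurable]: "A \<in> sets borel"
  shows "(\<integral>\<^sup>+x. ennreal (normal_density 0 \<sigma> x) * indicator A (x / \<sigma>) \<partial>lborel)
    = emeasure std_normal_distribution A"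
proof -
  interpret prob_space "density lborel (\<lambda>x. ennreal (normal_density 0 \<sigma> x))"
    using assms by (intro prob_space_normal_density)
  let ?N = "density lborel (\<lambda>x. ennreal (normal_density 0 \<sigma> x))"
  have "distributed ?N lborel (\<lambda>x. x) (\<lambda>x. ennreal (normal_density 0 \<sigma> x))"
    by (simp add: distributed_def distr_id2)
  then have "distributed ?N lborel (\<lambda>x. (x - 0) / \<sigma>) (\<lambda>x. ennreal (std_normal_density x))"
    using normal_standard_normal_convert[OF assms(1), of "\<lambda>x. x" 0] by simp
  then have "emeasure std_normal_distribution A = emeasure (distr ?N lborel (\<lambda>x. x / \<sigma>)) A"
    by (simp add: distributed_def)
  also have "\<dots> = (\<integral>\<^sup>+x. indicator A x \<partial>distr ?N lborel (\<lambda>x. x / \<sigma>))"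
    by simp
  also have "\<dots> = (\<integral>\<^sup>+x. ennreal (normal_density 0 \<sigma> x) * indicator A (x / \<sigma>) \<partial>lborel)"
    by (subst nn_integral_distr) (simp_all add: nn_integral_density)
  finally show ?thesis ..
qed

lemma normal_vector_coordinates:
  assumes \<sigma>: "0 < \<sigma>"
  shows "distr (normal_vector \<sigma> :: 'a::euclidean_space measure) (\<Pi>\<^sub>M b\<in>Basis. borel)
           (\<lambda>v. \<lambda>b\<in>Basis. (v \<bullet> b) / \<sigma>) = (\<Pi>\<^sub>M b\<in>Basis. std_normal_distribution)" (is "?D = ?P")
proof -
  interpret std: prob_space std_normal_distribution by (rule prob_space_std_normal)
  interpret product_prob_space "\<lambda>_::'a. std_normal_distribution" ..
  show ?thesis
  proof (rule PiM_eqI)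
    show "sets ?D = sets ?P" by (simp cong: sets_PiM_cong)
    fix A :: "'a \<Rightarrow> real set"
    assume "\<And>b. b \<in> Basis \<Longrightarrow> A b \<in> sets std_normal_distribution"
    then have [measurable]: "\<And>b. b \<in> Basis \<Longrightarrow> A b \<in> sets borel" by simp
    have "emeasure ?D (Pi\<^sub>E Basis A) = (\<integral>\<^sup>+v. indicator (Pi\<^sub>E Basis A) v \<partial>?D)"
      by (subst nn_integral_indicator) auto
    also have "\<dots> = (\<integral>\<^sup>+v. ennreal (\<Prod>b\<in>Basis. normal_density 0 \<sigma> (v \<bullet> b))
        * indicator (Pi\<^sub>E Basis A) (\<lambda>b\<in>Basis. (v \<bullet> b) / \<sigma>) \<partial>lborel)"
      by (subst nn_integral_distr) (auto simp: nn_integral_density)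
    also have "\<dots> = (\<integral>\<^sup>+v. (\<Prod>b\<in>Basis. ennreal (normal_density 0 \<sigma> (v \<bullet> b)) * indicator (A b) ((v \<bullet> b) / \<sigma>)) \<partial>(lborel :: 'a measure))"
    proof (rule nn_integral_cong)
      fix v :: 'a
      have "indicator (Pi\<^sub>E Basis A) (\<lambda>b\<in>Basis. (v \<bullet> b) / \<sigma>)
          = (\<Prod>b\<in>Basis. indicator (A b) ((v \<bullet> b) / \<sigma>) :: ennreal)"
      proof (cases "\<forall>b\<in>Basis. (v \<bullet> b) / \<sigma> \<in> A b")
        case True
        then show ?thesis by (simp add: restrict_PiE_iff)
      next
        case False
        then have "(\<lambda>b\<in>Basis. (v \<bullet> b) / \<sigma>) \<notin> Pi\<^sub>E Basis A" by (simp only: restrict_PiE_iff) simp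
        moreover have "(\<Prod>b\<in>Basis. indicator (A b) ((v \<bullet> b) / \<sigma>) :: ennreal) = 0"
          using False by (intro prod_zero) (auto simp: indicator_eq_0_iff)
        ultimately show ?thesis by (metis indicator_simps(2))
      qed
      then show "ennreal (\<Prod>b\<in>Basis. normal_density 0 \<sigma> (v \<bullet> b))
        * indicator (Pi\<^sub>E Basis A) (\<lambda>b\<in>Basis. (v \<bullet> b) / \<sigma>)
        = (\<Prod>b\<in>Basis. ennreal (normal_density 0 \<sigma> (v \<bullet> b)) * indicator (A b) ((v \<bullet> b) / \<sigma>))"
        by (simp only: prod.distrib prod_ennreal normal_density_nonneg)
    qed
    also have "\<dots> = (\<Prod>b\<in>Basis. emeasure std_normal_distribution (A b))"
      by (subst nn_integral_lborel_prod) (simp_all add: emeasure_normal_scaled[OF \<sigma>] cong: prod.cong)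
    finally show "emeasure ?D (Pi\<^sub>E Basis A) = (\<Prod>b\<in>Basis. emeasure std_normal_distribution (A b))" .
  qed simp
qed

lemma normal_vector_rotate:
  fixes f :: "'a::euclidean_space \<Rightarrow> 'a"
  assumes f: "orthogonal_transformation f"
  shows "distr (normal_vector \<sigma>) borel f = normal_vector \<sigma>"
proof -
  have inn: "f x \<bullet> f x = x \<bullet> x" for x
    using f by (simp add: orthogonal_transformation_def)
  have [measurable]: "f \<in> borel_measurable borel"
    using orthogonal_transformation_linear[OF f]
    by (intro borel_measurable_continuous_onI linear_continuous_on) (simp add: linear_conv_bounded_linear)
  have "normal_vector \<sigma> = density (distr lborel borel f) (\<lambda>v. ennreal (\<Prod>b\<in>Basis. normal_density 0 \<sigma> (v \<bullet> b)))"
    using lborel_orthogonal_transformation[OF f] by simp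
  also have "\<dots> = distr (density lborel (\<lambda>v. ennreal (\<Prod>b\<in>Basis. normal_density 0 \<sigma> (f v \<bullet> b)))) borel f"
    by (subst density_distr) auto
  finally show ?thesis
    by (simp add: prod_normal_density_eq inn)
qed

text \<open>Rotating the standard basis onto \<open>B\<close> does not change the law of the vector, so its
coordinates along \<open>B\<close> are distributed like those along the standard basis.\<close>

lemma normal_vector_orthonormal_coordinates:
  fixes B :: "'a::euclidean_space set"
  assumes \<sigma>: "0 < \<sigma>"
    and B: "pairwise orthogonal B" "\<And>b. b \<in> B \<Longrightarrow> norm b = 1" "card B = DIM('a)"
  shows "distr (normal_vector \<sigma>) (\<Pi>\<^sub>M b\<in>B. borel) (\<lambda>v. \<lambda>b\<in>B. (v \<bullet> b) / \<sigma>)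
      = (\<Pi>\<^sub>M b\<in>B. std_normal_distribution)"
proof -
  obtain Q :: "'a \<Rightarrow> 'a" where Q: "orthogonal_transformation Q" "bij_betw Q Basis B"
    using orthonormal_basis_map[OF B] by blast
  define R where "R = inv Q"
  have R: "orthogonal_transformation R"
    unfolding R_def using Q(1) by (rule orthogonal_transformation_inv)
  have QR: "Q (R x) = x" for x
    unfolding R_def using orthogonal_transformation_surj[OF Q(1)] by (rule surj_f_inv_f)
  have RQ: "R (Q x) = x" for x
    unfolding R_def using orthogonal_transformation_inj[OF Q(1)] by simp
  have [measurable]: "R \<in> borel_measurable borel"
    using orthogonal_transformation_linear[OF R]
    by (intro borel_measurable_continuous_onI linear_continuous_on) (simp add: linear_conv_bounded_linear)
  have inner: "R v \<bullet> R b = v \<bullet> b" for v b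
    using R by (simp add: orthogonal_transformation_def)
  have RB: "R b \<in> Basis" if "b \<in> B" for b
    using Q(2) that RQ by (auto simp: bij_betw_def)
  let ?P = "\<lambda>I::'a set. \<Pi>\<^sub>M b\<in>I. std_normal_distribution"
  have "?P B = distr (?P Basis) (?P B) (\<lambda>z. \<lambda>b\<in>B. z (R b))"
    using RB QR by (intro distr_PiM_reindex[symmetric] prob_space_std_normal inj_onI)
      (auto, metis)
  also have "?P Basis = distr (distr (normal_vector \<sigma>) borel R) (\<Pi>\<^sub>M b\<in>Basis. borel)
           (\<lambda>v. \<lambda>b\<in>Basis. (v \<bullet> b) / \<sigma>)"
    by (simp add: normal_vector_rotate[OF R] normal_vector_coordinates[OF \<sigma>])
  also have "\<dots> = distr (normal_vector \<sigma>) (\<Pi>\<^sub>M b\<in>Basis. borel) (\<lambda>v. \<lambda>b\<in>Basis. (R v \<bullet> b) / \<sigma>)"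
    by (subst distr_distr) (auto simp: comp_def)
  also have "distr \<dots> (?P B) (\<lambda>z. \<lambda>b\<in>B. z (R b))
      = distr (normal_vector \<sigma>) (\<Pi>\<^sub>M b\<in>B. borel) (\<lambda>v. \<lambda>b\<in>B. (R v \<bullet> R b) / \<sigma>)"
  proof (subst distr_distr)
    show "(\<lambda>z. \<lambda>b\<in>B. z (R b)) \<in> (\<Pi>\<^sub>M b\<in>Basis. borel) \<rightarrow>\<^sub>M ?P B"
      using RB by (intro measurable_restrict) auto
  qed (auto simp: comp_def RB intro!: distr_cong sets_PiM_cong cong: restrict_cong)
  finally show ?thesis by (simp add: inner)
qed

section \<open>Independence of a coordinate and a sum of squares\<close>

lemma chi_square_of_normal_family:
  assumes J: "finite J" and JB: "J \<subseteq> B"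
    and X: "distr M (\<Pi>\<^sub>M b\<in>B. borel) (\<lambda>\<omega>. \<lambda>b\<in>B. X b \<omega>) = (\<Pi>\<^sub>M b\<in>(B :: 'b set). std_normal_distribution)"
    and [measurable]: "\<And>b. b \<in> B \<Longrightarrow> X b \<in> borel_measurable M"
  shows "distr M borel (\<lambda>\<omega>. \<Sum>b\<in>J. (X b \<omega>)\<^sup>2) = chi_square (card J)"
proof -
  obtain p where p: "bij_betw p {..<card J} J"
    using finite_same_card_bij[of "{..<card J}" J] J by auto
  have pB: "p j \<in> B" if "j < card J" for j
    using p JB that by (auto simp: bij_betw_def)
  let ?P = "\<Pi>\<^sub>M b\<in>B. std_normal_distribution"
  let ?m = "{..<card J}"
  have "distr ?P (\<Pi>\<^sub>M j\<in>?m. std_normal_distribution) (\<lambda>z. \<lambda>j\<in>?m. z (p j))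
      = (\<Pi>\<^sub>M j\<in>?m. std_normal_distribution)"
    using p pB by (intro distr_PiM_reindex prob_space_std_normal) (auto simp: bij_betw_def)
  then have "chi_square (card J) =
      distr (distr ?P (\<Pi>\<^sub>M j\<in>?m. std_normal_distribution) (\<lambda>z. \<lambda>j\<in>?m. z (p j))) borel (\<lambda>z. \<Sum>j\<in>?m. (z j)\<^sup>2)"
    by (simp add: chi_square_def)
  also have "\<dots> = distr ?P borel (\<lambda>z. \<Sum>j\<in>?m. (z (p j))\<^sup>2)"
    using pB by (subst distr_distr) (auto simp: comp_def intro!: measurable_restrict)
  also have "(\<lambda>z. \<Sum>j\<in>?m. (z (p j))\<^sup>2) = (\<lambda>z. \<Sum>b\<in>J. (z b :: real)\<^sup>2)"
    using sum.reindex_bij_betw[OF p, of "\<lambda>b. (z b)\<^sup>2" for z :: "'b \<Rightarrow> real"] by (intro ext)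
  also have "distr ?P borel \<dots> = distr M borel (\<lambda>\<omega>. \<Sum>b\<in>J. (X b \<omega>)\<^sup>2)"
    unfolding X[symmetric] using JB
    by (subst distr_distr) (auto simp: comp_def subset_eq intro!: distr_cong sum.cong)
  finally show ?thesis ..
qed

text \<open>Functions of disjoint groups of coordinates of a standard normal family are independent. For
the regression, coordinate \<open>a\<close> carries the estimator of a single coefficient and the group
\<open>J\<close> carries the residual.\<close>

lemma (in prob_space) normal_chi_square_joint_law:
  assumes J: "finite J" "J \<subseteq> B" and a: "a \<in> B" "a \<notin> J"
    and X: "distr M (\<Pi>\<^sub>M b\<in>B. borel) (\<lambda>\<omega>. \<lambda>b\<in>B. X b \<omega>) = (\<Pi>\<^sub>M b\<in>B. std_normal_distribution)"
    and rv[measurable]: "\<And>b. b \<in> B \<Longrightarrow> random_variable borel (X b)"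
  shows "distr M (borel \<Otimes>\<^sub>M borel) (\<lambda>\<omega>. (X a \<omega>, \<Sum>b\<in>J. (X b \<omega>)\<^sup>2))
      = std_normal_distribution \<Otimes>\<^sub>M chi_square (card J)"
proof -
  have law: "distr M borel (X b) = std_normal_distribution" if "b \<in> B" for b
  proof -
    have "std_normal_distribution = distr (\<Pi>\<^sub>M b\<in>B. std_normal_distribution) std_normal_distribution (\<lambda>z. z b)"
      using distr_PiM_component[of B "\<lambda>_. std_normal_distribution" b] prob_space_std_normal that by simp
    also have "\<dots> = distr M std_normal_distribution (\<lambda>\<omega>. X b \<omega>)"
      unfolding X[symmetric] using that by (subst distr_distr) (auto simp: comp_def intro!: measurable_restrict)
    also have "\<dots> = distr M borel (X b)" by (intro distr_cong) auto
    finally show ?thesis ..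
  qed
  have "(\<Pi>\<^sub>M b\<in>B. std_normal_distribution) = (\<Pi>\<^sub>M b\<in>B. distr M borel (X b))"
    by (intro PiM_cong) (simp_all add: law)
  then have "indep_vars (\<lambda>_. borel) X B"
    using a(1) X by (subst indep_vars_iff_distr_eq_PiM') auto
  then have "indep_vars (\<lambda>_. borel) X (insert a J)"
    by (rule indep_vars_subset) (use J a in auto)
  then have "indep_vars (\<lambda>_. borel) (\<lambda>b \<omega>. (if b = a then X b \<omega> else (X b \<omega>)\<^sup>2)) (insert a J)"
    by (rule indep_vars_compose2[where Y="\<lambda>b x. if b = a then x else x\<^sup>2"]) simp
  then have "indep_var borel (\<lambda>\<omega>. if a = a then X a \<omega> else (X a \<omega>)\<^sup>2)
      borel (\<lambda>\<omega>. \<Sum>b\<in>J. if b = a then X b \<omega> else (X b \<omega>)\<^sup>2)"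
    using J a by (intro indep_vars_sum)
  moreover have "(\<Sum>b\<in>J. if b = a then X b \<omega> else (X b \<omega>)\<^sup>2) = (\<Sum>b\<in>J. (X b \<omega>)\<^sup>2)" for \<omega>
    using a by (intro sum.cong) auto
  ultimately have "indep_var borel (X a) borel (\<lambda>\<omega>. \<Sum>b\<in>J. (X b \<omega>)\<^sup>2)"
    by simp
  then show ?thesis
    by (simp add: indep_var_distribution_eq law[OF a(1)] chi_square_of_normal_family[OF J X rv])
qed

section \<open>Density of the scaled chi law\<close>

text \<open>The law whose density is \<open>rho m\<close>: that of \<open>sigma_hat / \<sigma>\<close> for \<open>m\<close> residual degrees of freedom.\<close>

definition scaled_chi :: "nat \<Rightarrow> real measure" where
  "scaled_chi m = distr (chi_square m) borel (\<lambda>q. sqrt q / sqrt (real m))"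

lemma sets_chi_square [simp, measurable_cong]: "sets (chi_square m) = sets borel"
  by (simp add: chi_square_def)

lemma prob_space_chi_square: "prob_space (chi_square m)"
proof -
  interpret prob_space "Pi\<^sub>M {..<m} (\<lambda>_. std_normal_distribution)"
    by (intro prob_space_PiM prob_space_std_normal)
  show ?thesis unfolding chi_square_def by (intro prob_space_distr) simp
qed

lemma prob_space_scaled_chi: "prob_space (scaled_chi m)"
  unfolding scaled_chi_def by (intro prob_space.prob_space_distr prob_space_chi_square) simp

lemma sets_scaled_chi [simp, measurable_cong]: "sets (scaled_chi m) = sets borel"
  by (simp add: scaled_chi_def)

lemma AE_scaled_chi_nonneg: "AE s in scaled_chi m. 0 \<le> s"
proof -
  have "AE q in chi_square m. 0 \<le> q"
    unfolding chi_square_def by (subst AE_distr_iff) (auto simp: sum_nonneg)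
  then show ?thesis
    unfolding scaled_chi_def by (subst AE_distr_iff) auto
qed

text \<open>Off the point \<open>0\<close>, the map \<open>y \<mapsto> sqrt (y\<^sup>2 + c) / sqrt m\<close> has the two differentiable local
inverses \<open>t \<mapsto> \<plusminus> sqrt (m * t\<^sup>2 - c)\<close>, and differentiable maps send null sets to null sets.\<close>

lemma null_sets_sqrt_square_add:
  assumes A: "A \<in> null_sets lborel" and c: "0 \<le> c" and m: "0 < m"
  shows "(\<lambda>y. sqrt (y\<^sup>2 + c) / sqrt m) -` A \<in> null_sets lborel"
proof -
  let ?S = "A \<inter> {t. m * t\<^sup>2 > c}"
  have negA: "negligible ?S"
    using A by (meson Int_lower1 completion.complete2 negligible_iff_null_sets null_sets_completionI)
  have diff: "(\<lambda>t. \<epsilon> * sqrt (m * t\<^sup>2 - c)) differentiable_on ?S" for \<epsilon>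
    unfolding differentiable_on_def
  proof
    fix t assume "t \<in> ?S"
    then have "((\<lambda>t. \<epsilon> * sqrt (m * t\<^sup>2 - c)) has_real_derivative \<epsilon> * (m * t / sqrt (m * t\<^sup>2 - c))) (at t within ?S)"
      by (auto intro!: derivative_eq_intros simp: field_simps)
    then show "(\<lambda>t. \<epsilon> * sqrt (m * t\<^sup>2 - c)) differentiable (at t within ?S)"
      by (auto simp: real_differentiable_def)
  qed
  have "negligible ((\<lambda>t. \<epsilon> * sqrt (m * t\<^sup>2 - c)) ` ?S)" for \<epsilon> :: real
    by (rule negligible_differentiable_image_negligible[OF _ negA diff]) simp
  then have "negligible ({0} \<union> ((\<lambda>t. 1 * sqrt (m * t\<^sup>2 - c)) ` ?S \<union> (\<lambda>t. -1 * sqrt (m * t\<^sup>2 - c)) ` ?S))"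
    by (intro negligible_Un) blast+
  moreover have "(\<lambda>y. sqrt (y\<^sup>2 + c) / sqrt m) -` A
      \<subseteq> {0} \<union> ((\<lambda>t. 1 * sqrt (m * t\<^sup>2 - c)) ` ?S \<union> (\<lambda>t. -1 * sqrt (m * t\<^sup>2 - c)) ` ?S)"
  proof
    fix y assume y: "y \<in> (\<lambda>y. sqrt (y\<^sup>2 + c) / sqrt m) -` A"
    define t where "t = sqrt (y\<^sup>2 + c) / sqrt m"
    have t: "m * t\<^sup>2 = y\<^sup>2 + c"
      using c m by (simp add: t_def power_divide)
    have tA: "t \<in> A" using y by (simp add: t_def)
    show "y \<in> {0} \<union> ((\<lambda>t. 1 * sqrt (m * t\<^sup>2 - c)) ` ?S \<union> (\<lambda>t. -1 * sqrt (m * t\<^sup>2 - c)) ` ?S)"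
    proof (cases "y = 0")
      case False
      then have "t \<in> ?S" using tA t by simp
      moreover have "y = 1 * sqrt (m * t\<^sup>2 - c) \<or> y = -1 * sqrt (m * t\<^sup>2 - c)"
        by (auto simp: t)
      ultimately show ?thesis by blast
    qed simp
  qed
  ultimately have "negligible ((\<lambda>y. sqrt (y\<^sup>2 + c) / sqrt m) -` A)"
    by (rule negligible_subset)
  moreover have "(\<lambda>y. sqrt (y\<^sup>2 + c) / sqrt m) -` A \<in> sets borel"
    using null_setsD2[OF A] measurable_sets[of "\<lambda>y. sqrt (y\<^sup>2 + c) / sqrt m" borel borel A] by simp
  ultimately show ?thesis
    by (simp add: negligible_iff_null_sets null_sets_completion_iff)
qed

text \<open>Conditionally on all normal variables but one, the scaled chi variable is
\<open>sqrt (y\<^sup>2 + c) / sqrt m\<close> with \<open>y\<close> standard normal and \<open>c\<close> fixed. So it avoids a null set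
almost surely.\<close>

lemma scaled_chi_absolutely_continuous:
  assumes "0 < m" shows "absolutely_continuous lborel (scaled_chi m)"
  unfolding absolutely_continuous_def
proof
  fix A :: "real set" assume A: "A \<in> null_sets lborel"
  then have [measurable]: "A \<in> sets borel" by auto
  interpret std: prob_space std_normal_distribution by (rule prob_space_std_normal)
  interpret product_prob_space "\<lambda>_::nat. std_normal_distribution" ..
  obtain k where k: "m = Suc k" using assms by (metis gr0_conv_Suc)
  then have ins: "{..<m} = insert k {..<k}" by auto
  let ?P = "\<lambda>I::nat set. \<Pi>\<^sub>M i\<in>I. std_normal_distribution"
  have "emeasure (scaled_chi m) A = (\<integral>\<^sup>+z. indicator A (sqrt (\<Sum>j<m. (z j)\<^sup>2) / sqrt (real m)) \<partial>?P {..<m})"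
  proof -
    have "emeasure (scaled_chi m) A = (\<integral>\<^sup>+s. indicator A s \<partial>scaled_chi m)" by simp
    also have "\<dots> = (\<integral>\<^sup>+z. indicator A (sqrt (\<Sum>j<m. (z j)\<^sup>2) / sqrt (real m)) \<partial>?P {..<m})"
      unfolding scaled_chi_def chi_square_def by (simp add: nn_integral_distr del: nn_integral_indicator)
    finally show ?thesis .
  qed
  also have "\<dots> = (\<integral>\<^sup>+x. (\<integral>\<^sup>+y. indicator A (sqrt (\<Sum>j<m. ((x(k := y)) j)\<^sup>2) / sqrt (real m))
      \<partial>std_normal_distribution) \<partial>?P {..<k})"
    unfolding ins by (rule product_nn_integral_insert) (auto simp flip: ins)
  also have "\<dots> = (\<integral>\<^sup>+x. 0 \<partial>?P {..<k})"
  proof (rule nn_integral_cong)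
    fix x :: "nat \<Rightarrow> real"
    let ?c = "\<Sum>j<k. (x j)\<^sup>2"
    have null: "(\<lambda>y. sqrt (y\<^sup>2 + ?c) / sqrt (real m)) -` A \<in> null_sets std_normal_distribution"
      using null_sets_sqrt_square_add[OF A, of ?c "real m"] assms
      by (intro set_mp[OF absolutely_continuousI_density[unfolded absolutely_continuous_def]])
        (auto simp: sum_nonneg)
    have "(\<Sum>j<m. ((x(k := y)) j)\<^sup>2) = y\<^sup>2 + ?c" for y
      by (simp add: k add.commute)
    then have "(\<integral>\<^sup>+y. indicator A (sqrt (\<Sum>j<m. ((x(k := y)) j)\<^sup>2) / sqrt (real m)) \<partial>std_normal_distribution)
      = (\<integral>\<^sup>+y. indicator ((\<lambda>y. sqrt (y\<^sup>2 + ?c) / sqrt (real m)) -` A) y \<partial>std_normal_distribution)"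
      by (simp add: indicator_def)
    also have "\<dots> = 0" using null by (subst nn_integral_indicator) auto
    finally show "(\<integral>\<^sup>+y. indicator A (sqrt (\<Sum>j<m. ((x(k := y)) j)\<^sup>2) / sqrt (real m)) \<partial>std_normal_distribution) = 0" .
  qed
  finally show "A \<in> null_sets (scaled_chi m)" using A by auto
qed

lemma rho_nonneg: "0 \<le> rho m s"
  by (simp add: rho_def)

lemma borel_measurable_rho [measurable]: "rho m \<in> borel_measurable borel"
  unfolding rho_def[abs_def] using borel_measurable_RN_deriv[of lborel] by simp

text \<open>A Radon-Nikodym derivative is characterised by its measure only up to null sets and need not be
finite everywhere; absolute continuity and finiteness of the law make the real-valued \<open>rho\<close> a
genuine density.\<close>

lemma scaled_chi_eq_density:
  assumes m: "0 < m" shows "scaled_chi m = density lborel (\<lambda>s. ennreal (rho m s))"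
proof -
  interpret prob_space "scaled_chi m" by (rule prob_space_scaled_chi)
  let ?f = "RN_deriv lborel (scaled_chi m)"
  have ac: "absolutely_continuous lborel (scaled_chi m)"
    using m by (rule scaled_chi_absolutely_continuous)
  have "scaled_chi m = density lborel ?f"
    by (rule sym, rule sigma_finite_measure.density_RN_deriv[OF sigma_finite_lborel ac]) simp
  also have "\<dots> = density lborel (\<lambda>s. ennreal (rho m s))"
  proof (rule density_cong)
    show "AE s in lborel. ?f s = ennreal (rho m s)"
      using sigma_finite_measure.RN_deriv_finite[OF sigma_finite_lborel sigma_finite_measure_axioms ac]
      by (auto simp: rho_def scaled_chi_def[symmetric] less_top elim!: eventually_mono)
  qed auto
  finally show ?thesis .
qed

text \<open>This replaces every integral against \<open>rho\<close> by an expectation under \<open>scaled_chi\<close>. The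
restriction to the half line is harmless because the law lives there.\<close>

lemma LINT_rho_eq:
  assumes m: "0 < m" and [measurable]: "f \<in> borel_measurable borel"
  shows "(LINT s:{0..}|lborel. f s * rho m s) = (\<integral>s. f s \<partial>scaled_chi m)"
proof -
  have "(\<integral>s. f s \<partial>scaled_chi m) = (\<integral>s. indicator {0..} s * f s \<partial>scaled_chi m)"
    using AE_scaled_chi_nonneg[of m] by (intro integral_cong_AE) (auto elim!: eventually_mono)
  also have "\<dots> = (\<integral>s. rho m s *\<^sub>R (indicator {0..} s * f s) \<partial>lborel)"
    unfolding scaled_chi_eq_density[OF m] by (intro integral_density) (auto simp: rho_nonneg)
  finally show ?thesis by (simp add: set_lebesgue_integral_def ac_simps)
qed

section \<open>Geometry of least squares\<close>

lemma inner_matrix_vector_transpose: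
  fixes A :: "real^'n^'m"
  shows "(A *v x) \<bullet> y = x \<bullet> (transpose A *v y)"
  by (metis dot_lmul_matrix inner_commute transpose_matrix_vector)

lemma matrix_inv_unique:
  fixes A B :: "real^'n^'n"
  assumes "A ** B = mat 1" "B ** A = mat 1"
  shows "matrix_inv A = B"
proof -
  have inv: "A ** matrix_inv A = mat 1 \<and> matrix_inv A ** A = mat 1"
    unfolding matrix_inv_def by (rule someI[where x=B]) (use assms in simp)
  have "matrix_inv A = (B ** A) ** matrix_inv A" by (simp add: assms)
  also have "\<dots> = B" using inv by (simp flip: matrix_mul_assoc)
  finally show ?thesis .
qed

lemma matrix_inv_scaleR_mat:
  assumes "c \<noteq> (0::real)"
  shows "matrix_inv (c *\<^sub>R mat 1 :: real^'n^'n) = (1 / c) *\<^sub>R mat 1"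
  using assms by (intro matrix_inv_unique) (simp_all add: matrix_scalar_ac)

lemma multivariate_normal_density_isotropic:
  fixes v :: "real^'n"
  assumes "0 < \<sigma>"
  shows "multivariate_normal_density 0 (\<sigma>\<^sup>2 *\<^sub>R mat 1) v = (\<Prod>b\<in>Basis. normal_density 0 \<sigma> (v \<bullet> b))"
proof -
  have det: "det (\<sigma>\<^sup>2 *\<^sub>R (mat 1 :: real^'n^'n)) = (\<sigma>\<^sup>2) ^ CARD('n)"
    by (simp add: det_diagonal mat_def)
  have "sqrt (2 * pi * \<sigma>\<^sup>2) ^ CARD('n) = sqrt ((2 * pi * \<sigma>\<^sup>2) ^ CARD('n))"
    by (simp add: real_sqrt_power)
  then show ?thesis using assms
    unfolding multivariate_normal_density_def prod_normal_density_eq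
    by (simp add: det matrix_inv_scaleR_mat scaleR_matrix_vector_assoc[symmetric] power_mult_distrib field_simps)
qed

text \<open>For \<open>Y = X \<theta> + u\<close>, each coefficient of the least-squares estimator is
\<open>\<theta>\<^sub>i\<close> plus the inner product of \<open>u\<close> with a fixed vector in the column space of \<open>X\<close>, called
the influence vector below, whereas the residual is the projection of \<open>u\<close> onto the orthogonal
complement of the column space. Both are therefore read off from disjoint sets of coordinates of
\<open>u\<close> in one orthonormal basis.\<close>

locale full_column_rank =
  fixes X :: "real^'k^'n"
  assumes rank: "rank X = CARD('k)"
begin

definition gram :: "real^'k^'k" where "gram = transpose X ** X"
definition gram_inv :: "real^'k^'k" where "gram_inv = matrix_inv gram"

lemma inj_X: "inj ((*v) X)"
  using rank full_rank_injective by blast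

lemma gram_inverse: "gram ** gram_inv = mat 1" "gram_inv ** gram = mat 1"
proof -
  have "inj ((*v) gram)"
  proof (rule linear_injective_0[THEN iffD2, rule_format])
    fix v assume "gram *v v = 0"
    then have "(X *v v) \<bullet> (X *v v) = 0"
      by (simp add: inner_matrix_vector_transpose matrix_vector_mul_assoc flip: gram_def del: transpose_matrix_vector)
    then show "v = 0"
      using inj_X by (metis inj_eq inner_eq_zero_iff matrix_vector_mult_0_right)
  qed simp
  then obtain L where "L ** gram = mat 1" using matrix_left_invertible_injective by blast
  then have "gram ** L = mat 1" using matrix_left_right_inverse by blast
  then have "gram_inv = L" unfolding gram_inv_def using \<open>L ** gram = mat 1\<close> by (intro matrix_inv_unique)
  then show "gram ** gram_inv = mat 1" "gram_inv ** gram = mat 1" using \<open>gram ** L = mat 1\<close> \<open>L ** gram = mat 1\<close> by auto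
qed

definition influence :: "'k \<Rightarrow> real^'n" where "influence i = X *v (transpose gram_inv *v axis i 1)"

lemma theta_LS_component: "theta_LS X (X *v \<theta> + u) $ i = \<theta> $ i + influence i \<bullet> u"
proof -
  have "theta_LS X (X *v \<theta> + u) = \<theta> + gram_inv *v (transpose X *v u)"
    using gram_inverse
    by (simp add: theta_LS_def matrix_vector_right_distrib matrix_vector_mul_assoc gram_def gram_inv_def)
  moreover have "(gram_inv *v (transpose X *v u)) $ i = influence i \<bullet> u"
  proof -
    have "influence i \<bullet> u = (transpose gram_inv *v axis i 1) \<bullet> (transpose X *v u)"
      by (simp add: influence_def inner_matrix_vector_transpose del: transpose_matrix_vector)
    also have "\<dots> = axis i 1 \<bullet> (gram_inv *v (transpose X *v u))"
      by (simp add: inner_matrix_vector_transpose transpose_transpose del: transpose_matrix_vector)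
    finally show ?thesis by (simp add: inner_axis' )
  qed
  ultimately show ?thesis by simp
qed

lemma influence_in_range: "influence i \<in> range ((*v) X)"
  by (simp add: influence_def)

lemma influence_nonzero: "influence i \<noteq> 0"
proof
  assume "influence i = 0"
  then have "transpose gram_inv *v axis i 1 = 0"
    unfolding influence_def using inj_X by (metis inj_eq matrix_vector_mult_0_right)
  then have "transpose (gram) *v (transpose gram_inv *v axis i 1) = 0" by simp
  then have "axis i (1::real) = 0"
    using gram_inverse by (simp add: matrix_vector_mul_assoc transpose_mat del: transpose_matrix_vector flip: matrix_transpose_mul)
  then show False by (simp add: axis_eq_0_iff)
qed

lemma xi_eq: "xi X i = sqrt (real CARD('n)) * norm (influence i)"
proof -
  have n: "(0::real) < real CARD('n)" by simp
  \<comment> \<open>The inverse of \<open>X'X/n\<close> is \<open>n\<close> times that of \<open>X'X\<close>, and the \<open>i\<close>-th diagonal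
    entry of the inverse of \<open>X'X\<close> is the squared length of the influence vector.\<close>
  have "matrix_inv ((1 / real CARD('n)) *\<^sub>R gram) = real CARD('n) *\<^sub>R gram_inv"
    using gram_inverse n
    by (intro matrix_inv_unique) (simp_all add: matrix_scalar_ac)
  moreover have "norm (influence i) ^ 2 = gram_inv $ i $ i"
  proof -
    have "influence i \<bullet> influence i = (transpose gram_inv *v axis i 1) \<bullet> (transpose X *v (X *v (transpose gram_inv *v axis i 1)))"
      by (simp add: influence_def inner_matrix_vector_transpose del: transpose_matrix_vector)
    also have "\<dots> = axis i 1 \<bullet> (gram_inv *v (gram *v (transpose gram_inv *v axis i 1)))"
      by (simp add: inner_matrix_vector_transpose transpose_transpose gram_def
          del: transpose_matrix_vector flip: matrix_vector_mul_assoc)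
    also have "\<dots> = axis i 1 \<bullet> (transpose gram_inv *v axis i 1)"
      using gram_inverse by (simp add: matrix_vector_mul_assoc)
    also have "\<dots> = gram_inv $ i $ i"
      by (simp add: inner_axis' matrix_vector_mul_component inner_axis transpose_def row_def)
    finally show ?thesis by (simp add: power2_norm_eq_inner)
  qed
  ultimately show ?thesis
    by (simp add: xi_def real_sqrt_mult flip: gram_def) (metis norm_ge_zero real_sqrt_unique)
qed

lemma residual_normal:
  assumes "r = y - X *v theta_LS X y"
  shows "(X *v v) \<bullet> r = 0"
proof -
  have "transpose X *v r = transpose X *v y - transpose X *v (X *v (gram_inv *v (transpose X *v y)))"
    by (simp only: assms theta_LS_def matrix_vector_mult_diff_distrib gram_def gram_inv_def)
  also have "\<dots> = transpose X *v y - (gram ** gram_inv) *v (transpose X *v y)"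
    by (simp only: gram_def matrix_vector_mul_assoc matrix_mul_assoc)
  also have "\<dots> = 0" by (simp add: gram_inverse)
  finally show ?thesis by (simp add: inner_matrix_vector_transpose del: transpose_matrix_vector)
qed

text \<open>An orthonormal basis \<open>J\<close> of the orthogonal complement of the column space, together with the
normalised influence vector, is extended to an orthonormal basis of the whole space. Expanding the
residual in \<open>J\<close> gives its squared length as the sum of the squared coordinates of \<open>u\<close> along
\<open>J\<close>, since \<open>X \<theta>\<close> and the fitted values have none.\<close>

lemma adapted_orthonormal_basis:
  obtains B J :: "(real^'n) set" and a
  where "pairwise orthogonal B" "\<And>b. b \<in> B \<Longrightarrow> norm b = 1" "card B = CARD('n)"
    and "J \<subseteq> B" "card J = CARD('n) - CARD('k)" "a \<in> B" "a \<notin> J" "influence i = norm (influence i) *\<^sub>R a"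
    and "\<And>\<theta> u. norm (X *v \<theta> + u - X *v theta_LS X (X *v \<theta> + u)) ^ 2 = (\<Sum>b\<in>J. (u \<bullet> b)\<^sup>2)"
proof -
  define C where "C = range ((*v) X)"
  define D where "D = {y. \<forall>x\<in>C. orthogonal x y}"
  have C: "subspace C" unfolding C_def by (intro linear_subspace_image) auto
  have D: "subspace D" unfolding D_def subspace_def by (auto simp: orthogonal_clauses)
  have "dim C = CARD('k)"
    unfolding C_def using rank by (simp add: rank_dim_range)
  moreover have "dim D + dim C = DIM(real^'n)"
    using dim_subspace_orthogonal_to_vectors[OF C subspace_UNIV] by (simp add: D_def)
  ultimately have dimD: "dim D = CARD('n) - CARD('k)" by simp
  obtain J where J: "J \<subseteq> D" "pairwise orthogonal J" "\<And>x. x \<in> J \<Longrightarrow> norm x = 1"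
      "independent J" "card J = dim D" "span J = D"
    using orthonormal_basis_subspace[OF D] by metis
  define a where "a = influence i /\<^sub>R norm (influence i)"
  have a: "norm a = 1" "influence i = norm (influence i) *\<^sub>R a" "a \<in> C"
    using influence_nonzero[of i] subspace_scale[OF C influence_in_range[of i, folded C_def]] by (simp_all add: a_def)
  have aJ: "a \<notin> J"
    using a(1,3) J(1) by (force simp: D_def orthogonal_def norm_eq_1)
  have "pairwise orthogonal (insert a J)"
    using J(1,2) a(3) by (auto simp: pairwise_insert D_def orthogonal_commute)
  then obtain U where U: "U \<inter> insert 0 (insert a J) = {}" "pairwise orthogonal (insert a J \<union> U)"
      "span (insert a J \<union> U) = span (insert a J \<union> UNIV)"
    using orthogonal_extension_strong[of "insert a J" UNIV] by metis
  \<comment> \<open>\<open>U\<close> consists of nonzero vectors of arbitrary length; normalising fixes the unit vectors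
    \<open>a\<close> and \<open>J\<close>.\<close>
  define W where "W = insert a J \<union> U"
  define B where "B = (\<lambda>x. x /\<^sub>R norm x) ` W"
  have W0: "0 \<notin> W" using U(1) a(1) J(3) unfolding W_def by force
  have "span W = UNIV" using U(3) by (simp add: W_def)
  have orth: "pairwise orthogonal B"
    using U(2)[folded W_def] by (auto simp: B_def pairwise_def orthogonal_def)
  have unit: "norm b = 1" if "b \<in> B" for b
  proof -
    obtain x where "x \<in> W" "b = x /\<^sub>R norm x" using \<open>b \<in> B\<close> by (auto simp: B_def)
    moreover from this have "x \<noteq> 0" using W0 by auto
    ultimately show ?thesis by simp
  qed
  have sub: "insert a J \<subseteq> B"
  proof
    fix x assume x: "x \<in> insert a J"
    then have "x = x /\<^sub>R norm x" using a(1) J(3) by auto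
    then show "x \<in> B" using x unfolding B_def W_def by blast
  qed
  have "W \<subseteq> span B"
  proof
    fix x assume x: "x \<in> W"
    then have "norm x *\<^sub>R (x /\<^sub>R norm x) \<in> span B"
      by (intro span_scale span_base) (simp add: B_def)
    then show "x \<in> span B" using x W0 by (cases "x = 0") auto
  qed
  then have "span B = UNIV"
    using \<open>span W = UNIV\<close> by (metis span_minimal subspace_span top.extremum_uniqueI)
  moreover have "independent B"
    using orth unit by (intro pairwise_orthogonal_independent) force+
  ultimately have card: "card B = CARD('n)"
    using indep_card_eq_dim_span[of B] by simp
  show thesis
  proof
    show "pairwise orthogonal B" "\<And>b. b \<in> B \<Longrightarrow> norm b = 1" "card B = CARD('n)"
      by (fact orth unit card)+
    show "J \<subseteq> B" "a \<in> B" using sub by auto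
    show "card J = CARD('n) - CARD('k)" using J dimD by simp
    show "a \<notin> J" "influence i = norm (influence i) *\<^sub>R a" by fact+
    fix \<theta> u
    define r where "r = X *v \<theta> + u - X *v theta_LS X (X *v \<theta> + u)"
    have rX: "(X *v v) \<bullet> r = 0" for v
      by (rule residual_normal) (simp add: r_def)
    then have "r \<in> D" by (auto simp: D_def C_def orthogonal_def)
    then have rJ: "r \<in> span J" using J by simp
    have finJ: "finite J" using J(4) independent_imp_finite by blast
    have inner: "r \<bullet> b = u \<bullet> b" if "b \<in> J" for b
    proof -
      have "X *v (\<theta> - theta_LS X (X *v \<theta> + u)) \<in> C" by (simp add: C_def)
      then have "(X *v (\<theta> - theta_LS X (X *v \<theta> + u))) \<bullet> b = 0"
        using J(1) that by (auto simp: D_def orthogonal_def)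
      then show ?thesis
        by (simp add: r_def matrix_vector_mult_diff_distrib inner_add_left inner_diff_left)
    qed
    have "norm r ^ 2 = r \<bullet> (\<Sum>b\<in>J. (r \<bullet> b) *\<^sub>R b)"
      using orthonormal_basis_expand[OF J(2,3) rJ finJ] by (simp add: power2_norm_eq_inner)
    also have "\<dots> = (\<Sum>b\<in>J. (r \<bullet> b)\<^sup>2)"
      by (simp add: inner_sum_right power2_eq_square)
    also have "\<dots> = (\<Sum>b\<in>J. (u \<bullet> b)\<^sup>2)" by (simp add: inner)
    finally show "norm (X *v \<theta> + u - X *v theta_LS X (X *v \<theta> + u)) ^ 2 = (\<Sum>b\<in>J. (u \<bullet> b)\<^sup>2)"
      by (simp add: r_def)
  qed
qed

end

section \<open>Hard thresholding of a normal variable at a random level\<close>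

abbreviation (input) \<Phi> :: "real \<Rightarrow> real" where "\<Phi> \<equiv> std_normal_cdf"

lemma std_normal_cdf_bounds: "0 \<le> \<Phi> x" "\<Phi> x \<le> 1"
proof -
  interpret real_distribution std_normal_distribution by (rule real_dist_normal_dist)
  show "0 \<le> \<Phi> x" "\<Phi> x \<le> 1"
    by (simp_all add: std_normal_cdf_def cdf_nonneg cdf_bounded_prob)
qed

lemma std_normal_cdf_mono: "x \<le> y \<Longrightarrow> \<Phi> x \<le> \<Phi> y"
proof -
  interpret real_distribution std_normal_distribution by (rule real_dist_normal_dist)
  show "x \<le> y \<Longrightarrow> \<Phi> x \<le> \<Phi> y"
    by (simp add: std_normal_cdf_def cdf_nondecreasing)
qed

lemma borel_measurable_std_normal_cdf [measurable]: "\<Phi> \<in> borel_measurable borel"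
  by (intro borel_measurable_mono monoI std_normal_cdf_mono)

lemma measure_std_normal_atMost: "measure std_normal_distribution {w. w \<le> y} = \<Phi> y"
  by (simp add: std_normal_cdf_def cdf_def atMost_def)

lemma measure_std_normal_lessThan: "measure std_normal_distribution {w. w < y} = \<Phi> y"
proof -
  have "AE w in std_normal_distribution. w \<noteq> y"
    using AE_lborel_singleton[of y] by (subst AE_density) (auto elim!: eventually_mono)
  then have "measure std_normal_distribution {w. w < y} = measure std_normal_distribution {w. w \<le> y}"
    by (intro measure_eq_AE) (auto elim!: eventually_mono)
  then show ?thesis by (simp add: measure_std_normal_atMost)
qed

lemma measure_std_normal_interval:
  assumes "a \<le> b"
  shows "measure std_normal_distribution {w. a \<le> w \<and> w \<le> b} = \<Phi> b - \<Phi> a"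
proof -
  interpret prob_space std_normal_distribution by (rule prob_space_std_normal)
  have "{w. a \<le> w \<and> w \<le> b} = {w. w \<le> b} - {w. w < a}" by auto
  then show ?thesis
    using assms by (simp add: finite_measure_Diff measure_std_normal_atMost measure_std_normal_lessThan subset_eq)
qed

definition hard_threshold :: "real \<Rightarrow> real \<Rightarrow> real" where
  "hard_threshold c t = t * of_bool (\<bar>t\<bar> > c)"

text \<open>A thresholded value is \<open>0\<close> or exceeds \<open>c\<close> in modulus. So for \<open>t\<close> between \<open>0\<close> and \<open>c\<close>,
being at most \<open>t\<close> means not being above \<open>c\<close>, and for negative \<open>t\<close> down to \<open>- c\<close> it means
being below \<open>- c\<close>.\<close>

lemma hard_threshold_le_iff:
  assumes "0 \<le> c"
  shows "hard_threshold c v \<le> t \<longleftrightarrow>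
    (if \<bar>t\<bar> > c then v \<le> t else if 0 \<le> t then v \<le> c else v < - c)"
  using assms by (auto simp: hard_threshold_def of_bool_def abs_if split: if_splits)

text \<open>The three summands are the conditional versions, for a given threshold \<open>c\<close>, of the three
summands of the distribution function; exactly one of them is nonzero.\<close>

lemma measure_hard_threshold_le:
  assumes pos: "0 < \<kappa>" "0 < \<alpha>" and c: "0 \<le> c"
  shows "measure std_normal_distribution {w. \<alpha> * (hard_threshold c (\<tau> + \<kappa> * w) - \<tau>) \<le> x} =
      \<Phi> (x / (\<alpha> * \<kappa>)) * of_bool (\<bar>x / \<alpha> + \<tau>\<bar> > c)
    + \<Phi> ((c - \<tau>) / \<kappa>) * of_bool (0 \<le> x / \<alpha> + \<tau> \<and> x / \<alpha> + \<tau> \<le> c)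
    + \<Phi> ((- c - \<tau>) / \<kappa>) * of_bool (- c \<le> x / \<alpha> + \<tau> \<and> x / \<alpha> + \<tau> < 0)"
proof -
  let ?t = "x / \<alpha> + \<tau>"
  have 1: "\<alpha> * (h - \<tau>) \<le> x \<longleftrightarrow> h \<le> ?t" for h
    using pos by (simp add: field_simps)
  have 2: "\<tau> + \<kappa> * w \<le> y \<longleftrightarrow> w \<le> (y - \<tau>) / \<kappa>" "\<tau> + \<kappa> * w < y \<longleftrightarrow> w < (y - \<tau>) / \<kappa>" for w y
    using pos by (simp_all add: field_simps)
  have 3: "(?t - \<tau>) / \<kappa> = x / (\<alpha> * \<kappa>)" by simp
  show ?thesis
    unfolding 1 hard_threshold_le_iff[OF c] 2 3 using c
    by (auto simp: measure_std_normal_atMost measure_std_normal_lessThan)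
qed

text \<open>Thresholding sends the event that the observation is at most \<open>c\<close> in modulus to the single point
\<open>- \<alpha> * \<tau>\<close>, which produces the atom. On the complementary event the normal variable is merely
rescaled by \<open>\<alpha> * \<kappa>\<close>, which produces the density.\<close>

lemma emeasure_hard_threshold:
  assumes pos: "0 < \<kappa>" "0 < \<alpha>" and c: "0 \<le> c" and A[measurable]: "A \<in> sets borel"
  shows "emeasure std_normal_distribution {w. \<alpha> * (hard_threshold c (\<tau> + \<kappa> * w) - \<tau>) \<in> A} =
      ennreal (\<Phi> ((c - \<tau>) / \<kappa>) - \<Phi> ((- c - \<tau>) / \<kappa>)) * indicator A (- \<alpha> * \<tau>)
    + (\<integral>\<^sup>+x. ennreal (std_normal_density (x / (\<alpha> * \<kappa>)) / (\<alpha> * \<kappa>)) * indicator A x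
          * of_bool (\<bar>x / \<alpha> + \<tau>\<bar> > c) \<partial>lborel)"
proof -
  interpret prob_space std_normal_distribution by (rule prob_space_std_normal)
  let ?in = "{w. \<bar>\<tau> + \<kappa> * w\<bar> \<le> c \<and> - \<alpha> * \<tau> \<in> A}"
  let ?out = "{w. \<bar>\<tau> + \<kappa> * w\<bar> > c \<and> \<alpha> * \<kappa> * w \<in> A}"
  have [measurable]: "?in \<in> sets borel" "?out \<in> sets borel" by measurable
  have "{w. \<alpha> * (hard_threshold c (\<tau> + \<kappa> * w) - \<tau>) \<in> A} = ?in \<union> ?out"
    by (auto simp: hard_threshold_def not_less algebra_simps)
  then have "emeasure std_normal_distribution {w. \<alpha> * (hard_threshold c (\<tau> + \<kappa> * w) - \<tau>) \<in> A}
      = emeasure std_normal_distribution ?in + emeasure std_normal_distribution ?out"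
    by (simp only:) (intro plus_emeasure[symmetric]; auto)
  also have "emeasure std_normal_distribution ?in
      = ennreal (\<Phi> ((c - \<tau>) / \<kappa>) - \<Phi> ((- c - \<tau>) / \<kappa>)) * indicator A (- \<alpha> * \<tau>)"
  proof (cases "- \<alpha> * \<tau> \<in> A")
    case True
    then have "?in = {w. (- c - \<tau>) / \<kappa> \<le> w \<and> w \<le> (c - \<tau>) / \<kappa>}"
      using pos by (auto simp: field_simps abs_le_iff)
    moreover have "(- c - \<tau>) / \<kappa> \<le> (c - \<tau>) / \<kappa>"
      using pos c by (simp add: divide_right_mono)
    ultimately show ?thesis
      using True by (simp add: emeasure_eq_measure measure_std_normal_interval)
  qed simp
  also have "emeasure std_normal_distribution ?out = (\<integral>\<^sup>+x.
      ennreal (std_normal_density (x / (\<alpha> * \<kappa>)) / (\<alpha> * \<kappa>)) * indicator A x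
          * of_bool (\<bar>x / \<alpha> + \<tau>\<bar> > c) \<partial>lborel)"
  proof -
    let ?f = "\<lambda>x. ennreal (std_normal_density (x / (\<alpha> * \<kappa>)) / (\<alpha> * \<kappa>)) * indicator A x
          * of_bool (\<bar>x / \<alpha> + \<tau>\<bar> > c)"
    have ak: "0 < \<alpha> * \<kappa>" using pos by simp
    have "(\<integral>\<^sup>+x. ?f x \<partial>lborel) = ennreal \<bar>\<alpha> * \<kappa>\<bar> * (\<integral>\<^sup>+w. ?f (0 + (\<alpha> * \<kappa>) * w) \<partial>lborel)"
      by (rule nn_integral_real_affine) (use ak in auto)
    also have "\<dots> = (\<integral>\<^sup>+w. ennreal (\<alpha> * \<kappa>) * ?f (\<alpha> * \<kappa> * w) \<partial>lborel)"
      using ak by (subst nn_integral_cmult) auto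
    also have "\<dots> = (\<integral>\<^sup>+w. ennreal (std_normal_density w) * indicator ?out w \<partial>lborel)"
    proof (rule nn_integral_cong)
      fix w
      have *: "ennreal (\<alpha> * \<kappa>) * (ennreal (d / (\<alpha> * \<kappa>)) * y) = ennreal d * y" for d y
      proof -
        have "ennreal (\<alpha> * \<kappa>) * ennreal (d / (\<alpha> * \<kappa>)) = ennreal (\<alpha> * \<kappa> * (d / (\<alpha> * \<kappa>)))"
          by (rule ennreal_mult'[symmetric]) (use ak in simp)
        then show ?thesis using pos by (simp flip: mult.assoc)
      qed
      have "\<alpha> * \<kappa> * w / (\<alpha> * \<kappa>) = w" "\<alpha> * \<kappa> * w / \<alpha> + \<tau> = \<tau> + \<kappa> * w"
        using pos by simp_all
      then show "ennreal (\<alpha> * \<kappa>) * ?f (\<alpha> * \<kappa> * w) = ennreal (std_normal_density w) * indicator ?out w"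
        unfolding mult.assoc[of "ennreal (_ / _)"] * by (auto simp: indicator_def)
    qed
    also have "\<dots> = emeasure std_normal_distribution ?out"
      by (simp add: emeasure_density)
    finally show ?thesis ..
  qed
  finally show ?thesis .
qed

text \<open>In units of \<open>\<sigma>\<close>, the estimated coefficient is \<open>\<tau> + \<kappa> * w\<close> with \<open>w\<close> standard normal, and
the threshold is \<open>c * s\<close> with \<open>s\<close> the independent ratio of the estimated to the true standard
deviation. The formulas hold for every law \<open>R\<close> of \<open>s\<close> on the half line.\<close>

locale hard_threshold_law = prob_space R for R :: "real measure" +
  fixes \<tau> \<kappa> c \<alpha> :: real
  assumes sets_R [simp, measurable_cong]: "sets R = sets borel"
    and R_nonneg: "AE s in R. 0 \<le> s"
    and pos: "0 < \<kappa>" "0 < c" "0 < \<alpha>"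
begin

definition law :: "real measure" where
  "law = distr (std_normal_distribution \<Otimes>\<^sub>M R) borel
     (\<lambda>(w, s). \<alpha> * (hard_threshold (c * s) (\<tau> + \<kappa> * w) - \<tau>))"

lemma measurable_threshold [measurable]:
  "(\<lambda>(w, s). \<alpha> * (hard_threshold (c * s) (\<tau> + \<kappa> * w) - \<tau>)) \<in> borel_measurable (borel \<Otimes>\<^sub>M borel)"
  unfolding hard_threshold_def by measurable

lemma integrable_bounded [intro]:
  assumes "f \<in> borel_measurable borel" "\<And>s. 0 \<le> f s" "\<And>s. f s \<le> (1::real)"
  shows "integrable R f"
  using assms by (intro integrable_const_bound[where B=1]) auto

lemma emeasure_law_conditional:
  assumes [measurable]: "A \<in> sets borel"
  shows "emeasure law A = (\<integral>\<^sup>+s. emeasure std_normal_distribution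
    {w. \<alpha> * (hard_threshold (c * s) (\<tau> + \<kappa> * w) - \<tau>) \<in> A} \<partial>R)"
proof -
  interpret std: prob_space std_normal_distribution by (rule prob_space_std_normal)
  interpret pair_prob_space std_normal_distribution R ..
  let ?S = "{(w, s). \<alpha> * (hard_threshold (c * s) (\<tau> + \<kappa> * w) - \<tau>) \<in> A}"
  have "?S \<in> sets (borel \<Otimes>\<^sub>M borel)"
    using measurable_sets[OF measurable_threshold, of A]
    by (simp add: vimage_def space_pair_measure case_prod_beta')
  then have S: "?S \<in> sets (std_normal_distribution \<Otimes>\<^sub>M R)"
    by (simp cong: sets_pair_measure_cong)
  have "emeasure law A = emeasure (std_normal_distribution \<Otimes>\<^sub>M R) ?S"
    unfolding law_def by (subst emeasure_distr)
      (auto simp: vimage_def space_pair_measure case_prod_beta' sets_eq_imp_space_eq[OF sets_R]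
        intro!: arg_cong2[where f=emeasure])
  also have "\<dots> = (\<integral>\<^sup>+s. emeasure std_normal_distribution ((\<lambda>w. (w, s)) -` ?S) \<partial>R)"
    by (rule emeasure_pair_measure_alt2[OF S])
  finally show ?thesis by (simp add: vimage_def)
qed

lemma cdf_law:
  "cdf law x =
      \<Phi> (x / (\<alpha> * \<kappa>)) * (\<integral>s. of_bool (\<bar>x / \<alpha> + \<tau>\<bar> > c * s) \<partial>R)
    + (\<integral>s. \<Phi> ((c * s - \<tau>) / \<kappa>) * of_bool (0 \<le> x / \<alpha> + \<tau> \<and> x / \<alpha> + \<tau> \<le> c * s) \<partial>R)
    + (\<integral>s. \<Phi> ((- (c * s) - \<tau>) / \<kappa>) * of_bool (- (c * s) \<le> x / \<alpha> + \<tau> \<and> x / \<alpha> + \<tau> < 0) \<partial>R)"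
    (is "_ = _ * integral\<^sup>L R ?f1 + integral\<^sup>L R ?f2 + integral\<^sup>L R ?f3")
proof -
  interpret std: prob_space std_normal_distribution by (rule prob_space_std_normal)
  let ?g = "\<lambda>s. \<Phi> (x / (\<alpha> * \<kappa>)) * ?f1 s + ?f2 s + ?f3 s"
  have int: "integrable R ?f1" "integrable R ?f2" "integrable R ?f3"
    by (intro integrable_bounded; auto simp: std_normal_cdf_bounds of_bool_def)+
  then have intg: "integrable R ?g" by auto
  have g0: "0 \<le> ?g s" for s by (simp add: std_normal_cdf_bounds)
  have "emeasure law {..x} = (\<integral>\<^sup>+s. ennreal (?g s) \<partial>R)"
    unfolding emeasure_law_conditional[OF atMost_borel]
  proof (rule nn_integral_cong_AE, use R_nonneg in eventually_elim)
    case (elim s)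
    then show ?case
      using measure_hard_threshold_le[OF pos(1,3), of "c * s" \<tau> x] pos(2)
      by (simp add: std.emeasure_eq_measure)
  qed
  also have "\<dots> = ennreal (\<integral>s. ?g s \<partial>R)"
    using g0 by (intro nn_integral_eq_integral intg) auto
  finally have "cdf law x = (\<integral>s. ?g s \<partial>R)"
    using g0 by (simp add: cdf_def measure_def)
  also have "\<dots> = \<Phi> (x / (\<alpha> * \<kappa>)) * integral\<^sup>L R ?f1 + integral\<^sup>L R ?f2 + integral\<^sup>L R ?f3"
    using int by (simp del: integral_mult_right_zero)
  finally show ?thesis .
qed

lemma emeasure_law:
  assumes A[measurable]: "A \<in> sets borel"
  shows "emeasure law A =
      ennreal (\<integral>s. \<Phi> ((c * s - \<tau>) / \<kappa>) - \<Phi> ((- (c * s) - \<tau>) / \<kappa>) \<partial>R)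
        * emeasure (return borel (- \<alpha> * \<tau>)) A
    + emeasure (density lborel (\<lambda>x. ennreal (std_normal_density (x / (\<alpha> * \<kappa>)) / (\<alpha> * \<kappa>)
        * (\<integral>s. of_bool (\<bar>x / \<alpha> + \<tau>\<bar> > c * s) \<partial>R)))) A"
proof -
  let ?d = "\<lambda>s. \<Phi> ((c * s - \<tau>) / \<kappa>) - \<Phi> ((- (c * s) - \<tau>) / \<kappa>)"
  let ?\<phi> = "\<lambda>x. std_normal_density (x / (\<alpha> * \<kappa>)) / (\<alpha> * \<kappa>)"
  let ?o = "\<lambda>x s. of_bool (\<bar>x / \<alpha> + \<tau>\<bar> > c * s)"
  have d0: "AE s in R. 0 \<le> ?d s"
    using R_nonneg pos by (auto elim!: eventually_mono intro!: std_normal_cdf_mono divide_right_mono)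
  have \<phi>0: "0 \<le> ?\<phi> x" for x using pos by simp
  interpret RL: pair_sigma_finite lborel R ..
  have "emeasure law A = (\<integral>\<^sup>+s. ennreal (?d s) * indicator A (- \<alpha> * \<tau>)
      + (\<integral>\<^sup>+x. ennreal (?\<phi> x) * indicator A x * ?o x s \<partial>lborel) \<partial>R)"
    unfolding emeasure_law_conditional[OF A]
  proof (rule nn_integral_cong_AE, use R_nonneg in eventually_elim)
    case (elim s)
    then show ?case
      using emeasure_hard_threshold[OF pos(1,3) _ A, of "c * s" \<tau>] pos(2) by simp
  qed
  also have "\<dots> = (\<integral>\<^sup>+s. ennreal (?d s) \<partial>R) * indicator A (- \<alpha> * \<tau>)
      + (\<integral>\<^sup>+s. (\<integral>\<^sup>+x. ennreal (?\<phi> x) * indicator A x * ?o x s \<partial>lborel) \<partial>R)"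
    by (subst nn_integral_add) (auto simp: nn_integral_multc)
  also have "(\<integral>\<^sup>+s. ennreal (?d s) \<partial>R) = ennreal (\<integral>s. ?d s \<partial>R)"
    by (intro nn_integral_eq_integral d0 Bochner_Integration.integrable_diff integrable_bounded)
      (auto simp: std_normal_cdf_bounds)
  also have "(\<integral>\<^sup>+s. (\<integral>\<^sup>+x. ennreal (?\<phi> x) * indicator A x * ?o x s \<partial>lborel) \<partial>R)
      = (\<integral>\<^sup>+x. (\<integral>\<^sup>+s. ennreal (?\<phi> x) * indicator A x * ?o x s \<partial>R) \<partial>lborel)"
    by (rule RL.Fubini') measurable
  also have "\<dots> = (\<integral>\<^sup>+x. ennreal (?\<phi> x * (\<integral>s. ?o x s \<partial>R)) * indicator A x \<partial>lborel)"
  proof (rule nn_integral_cong)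
    fix x
    have "(\<integral>\<^sup>+s. ennreal (?o x s) \<partial>R) = ennreal (\<integral>s. ?o x s \<partial>R)"
      by (intro nn_integral_eq_integral integrable_bounded) (auto simp: of_bool_def)
    moreover have "ennreal (?o x s) = ?o x s" for s by (simp add: of_bool_def)
    ultimately have "(\<integral>\<^sup>+s. ?o x s \<partial>R) = ennreal (\<integral>s. ?o x s \<partial>R)" by simp
    then have "(\<integral>\<^sup>+s. ennreal (?\<phi> x) * indicator A x * ?o x s \<partial>R)
        = (ennreal (?\<phi> x) * indicator A x) * ennreal (\<integral>s. ?o x s \<partial>R)"
      by (subst nn_integral_cmult) auto
    then show "(\<integral>\<^sup>+s. ennreal (?\<phi> x) * indicator A x * ?o x s \<partial>R)
        = ennreal (?\<phi> x * (\<integral>s. ?o x s \<partial>R)) * indicator A x"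
      by (simp only: ennreal_mult'[OF \<phi>0] mult_ac)
  qed
  also have "\<dots> = emeasure (density lborel (\<lambda>x. ennreal (?\<phi> x * (\<integral>s. ?o x s \<partial>R)))) A"
    by (subst emeasure_density) auto
  finally show ?thesis by simp
qed

end

section \<open>The hard-thresholding estimator\<close>

text \<open>The statement is the law of \<open>hard_threshold_law\<close> with \<open>\<tau> = \<theta>\<^sub>i / \<sigma>\<close>,
\<open>\<kappa> = \<xi>\<^sub>i / sqrt n\<close> and \<open>c = \<xi>\<^sub>i * \<eta>\<close>, where \<open>s\<close> follows the scaled chi law with \<open>n - k\<close>
degrees of freedom.\<close>

theorem proposition23:
  fixes M :: "'a measure"
    and X :: "real^'k^'n"
    and \<theta> :: "real^'k"
    and u Y :: "'a \<Rightarrow> real^'n"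
    and \<sigma> \<eta> \<alpha> :: real
    and i :: 'k
    and H :: "real measure"
  assumes "prob_space M"
    and "rank X = CARD('k)"
    and "CARD('k) < CARD('n)"
    and "0 < \<sigma>"
    and "distributed M lborel u (\<lambda>v. ennreal (multivariate_normal_density 0 (\<sigma>\<^sup>2 *\<^sub>R mat 1) v))"
    and "\<And>\<omega>. Y \<omega> = X *v \<theta> + u \<omega>"
    and "0 < \<eta>"
    and "0 < \<alpha>"
    and "H = distr M borel (\<lambda>\<omega>. inverse \<sigma> * \<alpha> * (theta_H X \<eta> i (Y \<omega>) - \<theta> $ i))"
  shows "(\<forall>x. cdf H x =
        std_normal_cdf (sqrt (real CARD('n)) * x / (\<alpha> * xi X i)) *
          (LINT s:{0..}|lborel. of_bool (\<bar>x / \<alpha> + \<theta> $ i / \<sigma>\<bar> > xi X i * s * \<eta>)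
             * rho (CARD('n) - CARD('k)) s)
      + (LINT s:{0..}|lborel.
             std_normal_cdf (sqrt (real CARD('n)) * (- \<theta> $ i / (\<sigma> * xi X i) + s * \<eta>))
             * of_bool (0 \<le> x / \<alpha> + \<theta> $ i / \<sigma> \<and> x / \<alpha> + \<theta> $ i / \<sigma> \<le> xi X i * s * \<eta>)
             * rho (CARD('n) - CARD('k)) s)
      + (LINT s:{0..}|lborel.
             std_normal_cdf (sqrt (real CARD('n)) * (- \<theta> $ i / (\<sigma> * xi X i) - s * \<eta>))
             * of_bool (- xi X i * s * \<eta> \<le> x / \<alpha> + \<theta> $ i / \<sigma> \<and> x / \<alpha> + \<theta> $ i / \<sigma> < 0)
             * rho (CARD('n) - CARD('k)) s))
    \<and> (\<forall>A \<in> sets borel. emeasure H A =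
        ennreal (LINT s:{0..}|lborel.
             (std_normal_cdf (sqrt (real CARD('n)) * (- \<theta> $ i / (\<sigma> * xi X i) + s * \<eta>))
              - std_normal_cdf (sqrt (real CARD('n)) * (- \<theta> $ i / (\<sigma> * xi X i) - s * \<eta>)))
             * rho (CARD('n) - CARD('k)) s)
          * emeasure (return borel (- \<alpha> * \<theta> $ i / \<sigma>)) A
      + emeasure (density lborel (\<lambda>x. ennreal
             (sqrt (real CARD('n)) * inverse \<alpha> * inverse (xi X i)
              * std_normal_density (sqrt (real CARD('n)) * x / (\<alpha> * xi X i))
              * (LINT s:{0..}|lborel. of_bool (\<bar>x / \<alpha> + \<theta> $ i / \<sigma>\<bar> > xi X i * s * \<eta>)
                   * rho (CARD('n) - CARD('k)) s)))) A)"
proof -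
  interpret M: prob_space M by fact
  interpret full_column_rank X by standard fact
  let ?n = "real CARD('n)" and ?m = "CARD('n) - CARD('k)"
  have m: "0 < ?m" using assms(3) by simp
  define \<kappa> where "\<kappa> = norm (influence i)"
  define \<tau> where "\<tau> = \<theta> $ i / \<sigma>"
  have \<sigma>: "0 < \<sigma>" and \<eta>: "0 < \<eta>" and \<alpha>: "0 < \<alpha>" by fact+
  have \<kappa>: "0 < \<kappa>" using influence_nonzero by (simp add: \<kappa>_def)
  have xi: "xi X i = sqrt ?n * \<kappa>" by (simp add: xi_eq \<kappa>_def)
  then have xi_pos: "0 < xi X i" using \<kappa> by simp
  obtain B J :: "(real^'n) set" and a
    where B: "pairwise orthogonal B" "\<And>b. b \<in> B \<Longrightarrow> norm b = 1" "card B = CARD('n)"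
      and J: "J \<subseteq> B" "card J = ?m" and a: "a \<in> B" "a \<notin> J" and wa: "influence i = norm (influence i) *\<^sub>R a"
      and res: "\<And>\<theta> u. norm (X *v \<theta> + u - X *v theta_LS X (X *v \<theta> + u)) ^ 2 = (\<Sum>b\<in>J. (u \<bullet> b)\<^sup>2)"
    using adapted_orthonormal_basis[of i] by metis
  have finJ: "finite J" using J m by (intro card_ge_0_finite) simp
  define Z where "Z b \<omega> = (u \<omega> \<bullet> b) / \<sigma>" for b \<omega>
  define S where "S \<omega> = sqrt (\<Sum>b\<in>J. (Z b \<omega>)\<^sup>2) / sqrt (real ?m)" for \<omega>
  have u_law: "distr M lborel u = normal_vector \<sigma>" and [measurable]: "u \<in> borel_measurable M"
    using assms(5) by (simp_all add: distributed_def multivariate_normal_density_isotropic[OF \<sigma>])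
  have [measurable]: "Z b \<in> borel_measurable M" for b
    unfolding Z_def by measurable
  have "distr M (\<Pi>\<^sub>M b\<in>B. borel) (\<lambda>\<omega>. \<lambda>b\<in>B. Z b \<omega>)
      = distr (distr M lborel u) (\<Pi>\<^sub>M b\<in>B. borel) (\<lambda>v. \<lambda>b\<in>B. (v \<bullet> b) / \<sigma>)"
    by (subst distr_distr) (auto simp: comp_def Z_def)
  also have "\<dots> = (\<Pi>\<^sub>M b\<in>B. std_normal_distribution)"
    unfolding u_law using B by (intro normal_vector_orthonormal_coordinates \<sigma>) auto
  finally have Z: "distr M (\<Pi>\<^sub>M b\<in>B. borel) (\<lambda>\<omega>. \<lambda>b\<in>B. Z b \<omega>) = (\<Pi>\<^sub>M b\<in>B. std_normal_distribution)" .
  interpret chi: prob_space "chi_square ?m" by (rule prob_space_chi_square)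
  have joint: "distr M (borel \<Otimes>\<^sub>M borel) (\<lambda>\<omega>. (Z a \<omega>, S \<omega>)) = std_normal_distribution \<Otimes>\<^sub>M scaled_chi ?m"
  proof -
    have "distr M (borel \<Otimes>\<^sub>M borel) (\<lambda>\<omega>. (Z a \<omega>, S \<omega>))
      = distr (distr M (borel \<Otimes>\<^sub>M borel) (\<lambda>\<omega>. (Z a \<omega>, \<Sum>b\<in>J. (Z b \<omega>)\<^sup>2))) (borel \<Otimes>\<^sub>M borel)
          (\<lambda>(x, q). (x, sqrt q / sqrt (real ?m)))"
      by (subst distr_distr) (auto simp: comp_def S_def)
    also have "\<dots> = distr (std_normal_distribution \<Otimes>\<^sub>M chi_square ?m) (borel \<Otimes>\<^sub>M borel)
          (\<lambda>(x, q). (x, sqrt q / sqrt (real ?m)))"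
      using M.normal_chi_square_joint_law[OF finJ J(1) a Z] by (simp add: J)
    also have "\<dots> = distr std_normal_distribution borel (\<lambda>x. x) \<Otimes>\<^sub>M scaled_chi ?m"
      unfolding scaled_chi_def
      by (intro pair_measure_distr[symmetric] prob_space_imp_sigma_finite chi.prob_space_distr) simp_all
    also have "distr std_normal_distribution borel (\<lambda>x. x) = std_normal_distribution"
      by (rule distr_id2) simp
    finally show ?thesis .
  qed
  interpret L: hard_threshold_law "scaled_chi ?m" \<tau> \<kappa> "xi X i * \<eta>" \<alpha>
  proof (intro hard_threshold_law.intro hard_threshold_law_axioms.intro)
    show "prob_space (scaled_chi ?m)" by (rule prob_space_scaled_chi)
    show "sets (scaled_chi ?m) = sets borel" by (rule sets_scaled_chi)
    show "AE s in scaled_chi ?m. 0 \<le> s" by (rule AE_scaled_chi_nonneg)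
    show "0 < \<kappa>" "0 < \<alpha>" by fact+
    show "0 < xi X i * \<eta>" using xi_pos \<eta> by (rule mult_pos_pos)
  qed
  have g: "inverse \<sigma> * \<alpha> * (theta_H X \<eta> i (Y \<omega>) - \<theta> $ i)
      = \<alpha> * (hard_threshold (xi X i * \<eta> * S \<omega>) (\<tau> + \<kappa> * Z a \<omega>) - \<tau>)" for \<omega>
  proof -
    have "influence i \<bullet> u \<omega> = \<kappa> * (u \<omega> \<bullet> a)"
      using arg_cong[OF wa, of "\<lambda>v. v \<bullet> u \<omega>"] by (simp add: \<kappa>_def inner_commute)
    then have ls: "theta_LS X (Y \<omega>) $ i = \<sigma> * (\<tau> + \<kappa> * Z a \<omega>)"
      using \<sigma> by (simp add: assms(6) theta_LS_component \<tau>_def Z_def distrib_left)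
    have "sigma_hat X (Y \<omega>) = sqrt (\<Sum>b\<in>J. (u \<omega> \<bullet> b)\<^sup>2) / sqrt (real ?m)"
      using res[of \<theta> "u \<omega>"] by (simp add: sigma_hat_def assms(6) power2_norm_eq_inner real_sqrt_divide)
    also have "(\<Sum>b\<in>J. (u \<omega> \<bullet> b)\<^sup>2) = \<sigma>\<^sup>2 * (\<Sum>b\<in>J. (Z b \<omega>)\<^sup>2)"
      using \<sigma> by (simp add: Z_def power_divide sum_distrib_left)
    finally have sh: "sigma_hat X (Y \<omega>) = \<sigma> * S \<omega>"
      using \<sigma> by (simp add: real_sqrt_mult S_def)
    have "\<bar>\<sigma> * t\<bar> > \<sigma> * S \<omega> * xi X i * \<eta> \<longleftrightarrow> \<bar>t\<bar> > xi X i * \<eta> * S \<omega>" for t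
      using \<sigma> by (simp add: abs_mult mult.assoc) (simp add: mult_ac)
    then have "theta_H X \<eta> i (Y \<omega>) = \<sigma> * hard_threshold (xi X i * \<eta> * S \<omega>) (\<tau> + \<kappa> * Z a \<omega>)"
      by (simp only: theta_H_def ls sh hard_threshold_def mult.assoc)
    moreover have "\<theta> $ i = \<sigma> * \<tau>" using \<sigma> by (simp add: \<tau>_def)
    ultimately have "theta_H X \<eta> i (Y \<omega>) - \<theta> $ i
        = \<sigma> * (hard_threshold (xi X i * \<eta> * S \<omega>) (\<tau> + \<kappa> * Z a \<omega>) - \<tau>)"
      by (simp only: right_diff_distrib)
    then show ?thesis using \<sigma> by simp
  qed
  have "H = distr M borel (\<lambda>\<omega>. \<alpha> * (hard_threshold (xi X i * \<eta> * S \<omega>) (\<tau> + \<kappa> * Z a \<omega>) - \<tau>))"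
    by (simp only: assms(9) g)
  also have "\<dots> = distr (distr M (borel \<Otimes>\<^sub>M borel) (\<lambda>\<omega>. (Z a \<omega>, S \<omega>))) borel
      (\<lambda>(w, s). \<alpha> * (hard_threshold (xi X i * \<eta> * s) (\<tau> + \<kappa> * w) - \<tau>))"
    by (subst distr_distr) (auto simp: comp_def S_def)
  finally have H: "H = L.law" by (simp add: joint L.law_def)
  \<comment> \<open>From here on only the notation differs: the statement writes \<open>sqrt n / \<xi>\<^sub>i\<close> for \<open>1 / \<kappa>\<close>.\<close>
  have c1: "sqrt ?n * x / (\<alpha> * xi X i) = x / (\<alpha> * \<kappa>)" for x
    using \<kappa> \<alpha> by (simp add: xi)
  have c2: "sqrt ?n * (- \<theta> $ i / (\<sigma> * xi X i) + s * \<eta>) = (xi X i * \<eta> * s - \<tau>) / \<kappa>"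
    and c3: "sqrt ?n * (- \<theta> $ i / (\<sigma> * xi X i) - s * \<eta>) = (- (xi X i * \<eta> * s) - \<tau>) / \<kappa>" for s
    using \<kappa> \<sigma> by (simp_all add: xi \<tau>_def field_simps)
  have c4: "xi X i * s * \<eta> = xi X i * \<eta> * s" "- xi X i * s * \<eta> = - (xi X i * \<eta> * s)" for s
    by simp_all
  have c5: "sqrt ?n * inverse \<alpha> * inverse (xi X i) * d = d / (\<alpha> * \<kappa>)" for d
    using \<kappa> \<alpha> by (simp add: xi field_simps)
  have c6: "- \<alpha> * \<theta> $ i / \<sigma> = - \<alpha> * \<tau>" by (simp add: \<tau>_def)
  show ?thesis
    unfolding H c1 c2 c3 c4 c5 c6 \<tau>_def[symmetric]
    by (intro conjI allI ballI; (subst LINT_rho_eq[OF m], measurable)+)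
      (auto simp: L.cdf_law L.emeasure_law)
qed

end
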